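(* Suppose $f(x,\theta)$ is continuously differentiable in $x$ for all $\theta\in\Theta$ and $g$ is continuously differentiable. Suppose there are constants $G_{f,x},G_g>0$ such that $\|\nabla_x f(x_1,\theta)-\nabla_x f(x_2,\theta)\|\le G_{f,x}\|x_1-x_2\|$ for all $x_1,x_2\in X$, $\theta\in\Theta$, and $\nabla_\theta g$ is Lipschitz continuous with constant $G_g$. Suppose $f(\cdot,\theta)$ is strongly convex with constant $\eta_f>0$ for all $\theta\in\Theta$, and $g$ is strongly convex with constant $\eta_g>0$. Let $\theta^*$ be the minimizer of $g$ over $\Theta$ and $x^*$ the minimizer of $f(\cdot,\theta^* )$ over $X$, and suppose $\theta\mapsto\nabla_x f(x^*,\theta)$ is Lipschitz continuous on $\Theta$ with constant $L_\theta$. Let $\gamma_{f,k}=\gamma_f$ and $\gamma_{g,k}=\gamma_g$ for all $k$, where $0<\gamma_f<2/G_{f,x}$ and $0<\gamma_g<2/G_g$. Then, for any $x_0\in X$, $\theta_0\in\Theta$, the sequence $\{(x_k,\theta_k)\}$ generated by the joint gradient scheme satisfies $x_k\to x^*$ and $\theta_k\to\theta^*$ as $k\to\infty$.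
   Context: $X\subseteq\mathbb{R}^n$ and $\Theta\subseteq\mathbb{R}^m$ are nonempty closed convex sets, $f:X\times\Theta\to\mathbb{R}$ is convex in $x$ for every $\theta\in\Theta$, and $g:\mathbb{R}^m\to\mathbb{R}$ is convex. $\Pi_Y$ denotes Euclidean projection onto $Y$. A differentiable function $h$ is strongly convex with constant $\eta$ if $(\nabla h(u)-\nabla h(v))^T(u-v)\ge\eta\|u-v\|^2$ for all $u,v$ in its domain of interest. The joint gradient scheme, given $x_0\in X$, $\theta_0\in\Theta$ and steplengths $\{\gamma_{f,k}\},\{\gamma_{g,k}\}$, is: for all $k\ge0$, $x_{k+1}=\Pi_X(x_k-\gamma_{f,k}\nabla_x f(x_k,\theta_k))$ and $\theta_{k+1}=\Pi_\Theta(\theta_k-\gamma_{g,k}\nabla_\theta g(\theta_k))$. *)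

theory Defs
  imports "HOL-Analysis.Analysis"
begin

(* The gradient is passed as a function rather than obtained by a choice operator: h need only be
   given on S, and if S has empty interior then the vector representing the derivative within S
   is not unique.  With S = UNIV this is the usual gradient on the whole space. *)
definition has_gradient_on ::
    "(real ^ 'n \<Rightarrow> real) \<Rightarrow> (real ^ 'n \<Rightarrow> real ^ 'n) \<Rightarrow> (real ^ 'n) set \<Rightarrow> bool" where
  "has_gradient_on h dh S \<longleftrightarrow>
     (\<forall>x\<in>S. (h has_derivative (\<lambda>v. dh x \<bullet> v)) (at x within S))"

definition continuously_differentiable_on ::
    "(real ^ 'n \<Rightarrow> real) \<Rightarrow> (real ^ 'n \<Rightarrow> real ^ 'n) \<Rightarrow> (real ^ 'n) set \<Rightarrow> bool" where
  "continuously_differentiable_on h dh S \<longleftrightarrow> has_gradient_on h dh S \<and> continuous_on S dh"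

definition strongly_convex_on ::
    "real \<Rightarrow> (real ^ 'n \<Rightarrow> real) \<Rightarrow> (real ^ 'n \<Rightarrow> real ^ 'n) \<Rightarrow> (real ^ 'n) set \<Rightarrow> bool" where
  "strongly_convex_on \<eta> h dh S \<longleftrightarrow> has_gradient_on h dh S \<and>
     (\<forall>u\<in>S. \<forall>v\<in>S. (dh u - dh v) \<bullet> (u - v) \<ge> \<eta> * (norm (u - v))\<^sup>2)"

(* closest_point S is the Euclidean projection onto S when S is nonempty, closed and convex. *)
definition joint_gradient_scheme ::
    "(real ^ 'n) set \<Rightarrow> (real ^ 'm) set \<Rightarrow>
     (real ^ 'n \<Rightarrow> real ^ 'm \<Rightarrow> real ^ 'n) \<Rightarrow> (real ^ 'm \<Rightarrow> real ^ 'm) \<Rightarrow>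
     (nat \<Rightarrow> real) \<Rightarrow> (nat \<Rightarrow> real) \<Rightarrow>
     (nat \<Rightarrow> real ^ 'n) \<Rightarrow> (nat \<Rightarrow> real ^ 'm) \<Rightarrow> bool" where
  "joint_gradient_scheme X \<Theta> dfx dg \<gamma>f \<gamma>g x \<theta> \<longleftrightarrow>
     x 0 \<in> X \<and> \<theta> 0 \<in> \<Theta> \<and>
     (\<forall>k. x (Suc k) = closest_point X (x k - \<gamma>f k *\<^sub>R dfx (x k) (\<theta> k)) \<and>
          \<theta> (Suc k) = closest_point \<Theta> (\<theta> k - \<gamma>g k *\<^sub>R dg (\<theta> k)))"

end

theory Submission
  imports Defs
begin

text \<open>For a fixed parameter, the projected gradient step is a contraction whose modulus does not depend
  on the parameter; the step for \<open>\<theta>\<close> contracts towards \<open>\<theta>star\<close>, and the step for \<open>x\<close> contracts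
  towards \<open>xstar\<close> up to an error proportional to the distance of \<open>\<theta>\<close> to \<open>\<theta>star\<close>, so a weighted
  sum of both distances decays geometrically. For all step lengths below \<open>2 / G\<close> the contraction
  rests on cocoercivity of the gradient. The usual proof of cocoercivity evaluates the
  function at an auxiliary point that may leave the domain, whereas here the gradient is controlled on
  the convex set only. It is therefore applied to close points of the relative interior,
  with the gradient projected onto the direction space of the affine hull; chaining the
  local inequalities along a segment and passing to the closure gives the global one.\<close>

section \<open>Orthogonal projection onto a subspace\<close>

text \<open>The projection is the Fourier sum over an orthonormal basis. The norm bound follows from
  the inner product identity at \<open>v = P w\<close> and Cauchy-Schwarz.\<close>

lemma projection_onto_subspace:
  fixes V :: "'a::euclidean_space set"
  assumes "subspace V"
  obtains P :: "'a \<Rightarrow> 'a" where "linear P" "\<And>w. P w \<in> V"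
    "\<And>w v. v \<in> V \<Longrightarrow> P w \<bullet> v = w \<bullet> v" "\<And>w. norm (P w) \<le> norm w"
proof -
  obtain B where B: "B \<subseteq> V" "pairwise orthogonal B" "\<And>b. b \<in> B \<Longrightarrow> norm b = 1"
    "independent B" "span B = V"
    using orthonormal_basis_subspace[OF assms] by metis
  have fin: "finite B"
    using B(4) independent_imp_finite by blast
  define P where "P w = (\<Sum>b\<in>B. (w \<bullet> b) *\<^sub>R b)" for w :: 'a
  have lin: "linear P"
    unfolding P_def by (rule linearI)
      (simp_all add: inner_add_left scaleR_add_left sum.distrib scaleR_sum_right)
  have mem: "P w \<in> V" for w
    unfolding P_def using B(1) assms by (meson subspace_scale subspace_sum subsetD)
  have on_basis: "P w \<bullet> c = w \<bullet> c" if "c \<in> B" for w c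
  proof -
    have "P w \<bullet> c = (\<Sum>b\<in>B. (w \<bullet> b) * (b \<bullet> c))"
      by (simp add: P_def inner_sum_left)
    also have "\<dots> = (\<Sum>b\<in>B. if b = c then w \<bullet> c else 0)"
    proof (rule sum.cong)
      fix b assume "b \<in> B"
      show "(w \<bullet> b) * (b \<bullet> c) = (if b = c then w \<bullet> c else 0)"
      proof (cases "b = c")
        case True
        then show ?thesis using B(3)[OF that] by (simp add: dot_square_norm)
      next
        case False
        then have "b \<bullet> c = 0"
          using B(2) \<open>b \<in> B\<close> that by (auto simp: pairwise_def orthogonal_def)
        then show ?thesis using False by simp
      qed
    qed simp
    also have "\<dots> = w \<bullet> c" using fin that by simp
    finally show ?thesis .
  qed
  have inner: "P w \<bullet> v = w \<bullet> v" if "v \<in> V" for w v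
  proof -
    have "v \<in> span B" using that B(5) by simp
    then have "(P w - w) \<bullet> v = 0"
    proof (induction rule: span_induct_alt)
      case base
      then show ?case by simp
    next
      case (step c b y)
      then show ?case using on_basis[of b w] by (simp add: inner_add_right inner_diff_left)
    qed
    then show ?thesis by (simp add: inner_diff_left)
  qed
  have "norm (P w) \<le> norm w" for w
  proof -
    have "norm (P w) * norm (P w) = w \<bullet> P w"
      using inner[OF mem, of w w] by (simp add: dot_square_norm power2_eq_square)
    also have "\<dots> \<le> norm w * norm (P w)"
      by (rule norm_cauchy_schwarz)
    finally show ?thesis
      by (cases "P w = 0") simp_all
  qed
  with lin mem inner show ?thesis using that by blast
qed

section \<open>Lipschitz gradients on a closed convex set\<close>

text \<open>Differentiation is within \<open>C\<close>. If \<open>C\<close> has empty interior, the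
  component of \<open>F u\<close> orthogonal to the affine hull is not determined by
  \<open>h\<close>, so information drawn from values of \<open>h\<close> concerns the projected
  gradient only.\<close>

locale lipschitz_gradient =
  fixes C :: "'a::euclidean_space set" and h :: "'a \<Rightarrow> real" and F :: "'a \<Rightarrow> 'a" and G :: real
  assumes convex: "convex C"
    and closed: "closed C"
    and gradient: "\<And>u. u \<in> C \<Longrightarrow> (h has_derivative (\<lambda>v. F u \<bullet> v)) (at u within C)"
    and lipschitz: "G-lipschitz_on C F"
    and G_pos: "G > 0"
begin

lemma segment_mem:
  assumes "u \<in> C" "v \<in> C" "s \<in> {0..1}"
  shows "u + s *\<^sub>R (v - u) \<in> C"
  using convexD[OF convex assms(1,2), of "1 - s" s] assms(3) by (simp add: algebra_simps)

lemma derivative_along_segment: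
  assumes "u \<in> C" "v \<in> C" "s \<in> {0..1}"
  shows "((\<lambda>s. h (u + s *\<^sub>R (v - u))) has_derivative
    (\<lambda>r. r * (F (u + s *\<^sub>R (v - u)) \<bullet> (v - u)))) (at s within {0..1})"
proof -
  have "(h has_derivative (\<lambda>w. F (u + s *\<^sub>R (v - u)) \<bullet> w))
      (at (u + s *\<^sub>R (v - u)) within (\<lambda>s. u + s *\<^sub>R (v - u)) ` {0..1})"
    by (rule has_derivative_subset[OF gradient]) (use segment_mem assms in auto)
  moreover have "((\<lambda>s. u + s *\<^sub>R (v - u)) has_derivative (\<lambda>r. r *\<^sub>R (v - u))) (at s within {0..1})"
    by (auto intro!: derivative_eq_intros)
  ultimately show ?thesis
    using has_derivative_in_compose[of "\<lambda>s. u + s *\<^sub>R (v - u)" "\<lambda>r. r *\<^sub>R (v - u)" s "{0..1}" h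
      "\<lambda>w. F (u + s *\<^sub>R (v - u)) \<bullet> w"]
    by simp
qed

lemma norm_gradient_diff_le:
  assumes "u \<in> C" "v \<in> C"
  shows "norm (F u - F v) \<le> G * norm (u - v)"
  using lipschitz_onD[OF lipschitz assms] by (simp add: dist_norm)

text \<open>The descent lemma. Instead of integrating the gradient along the segment, the linear and
  quadratic terms are subtracted first; the mean value theorem then shows that the remainder
  \<open>\<psi>\<close> does not increase from 0 to 1.\<close>

lemma le_quadratic_upper_bound:
  assumes "u \<in> C" "v \<in> C"
  shows "h v \<le> h u + F u \<bullet> (v - u) + G / 2 * (norm (v - u))\<^sup>2"
proof -
  define d where "d = v - u"
  define \<psi> where "\<psi> s = h (u + s *\<^sub>R d) - s * (F u \<bullet> d) - G / 2 * s\<^sup>2 * (norm d)\<^sup>2" for s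
  have der: "(\<psi> has_derivative (\<lambda>r. r * (F (u + s *\<^sub>R d) \<bullet> d) - r * (F u \<bullet> d) -
      r * (G * s * (norm d)\<^sup>2))) (at s within {0..1})" if "s \<in> {0..1}" for s
    unfolding \<psi>_def d_def
    by (rule derivative_eq_intros derivative_along_segment[OF assms that] refl)+
      (auto simp: algebra_simps)
  obtain s where s: "s \<in> {0<..<1}" and mvt: "\<psi> 1 - \<psi> 0 =
      (1 - 0) * (F (u + s *\<^sub>R d) \<bullet> d) - (1 - 0) * (F u \<bullet> d) - (1 - 0) * (G * s * (norm d)\<^sup>2)"
    using mvt_simple[of 0 1 \<psi>, OF _ der] by auto
  have "(F (u + s *\<^sub>R d) - F u) \<bullet> d \<le> norm (F (u + s *\<^sub>R d) - F u) * norm d"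
    by (rule norm_cauchy_schwarz)
  also have "\<dots> \<le> G * norm ((u + s *\<^sub>R d) - u) * norm d"
    by (intro mult_right_mono norm_gradient_diff_le)
      (use segment_mem[OF assms] assms s d_def in auto)
  also have "\<dots> = G * s * (norm d)\<^sup>2"
    using s by (simp add: power2_eq_square)
  finally have "\<psi> 1 \<le> \<psi> 0"
    using mvt by (simp add: inner_diff_left)
  then show ?thesis by (simp add: \<psi>_def d_def)
qed

text \<open>Moving from \<open>u\<close> towards \<open>v\<close> by a fraction \<open>s\<close>
  cannot decrease \<open>h\<close>. The quadratic upper bound, divided by \<open>s\<close>, gives
  the claim up to an error \<open>s * K\<close>, which vanishes as \<open>s\<close> tends to 0 from
  the right.\<close>

lemma variational_inequality:
  assumes "is_arg_min h (\<lambda>u. u \<in> C) u" "v \<in> C"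
  shows "F u \<bullet> (v - u) \<ge> 0"
proof -
  define K where "K = G / 2 * (norm (v - u))\<^sup>2"
  have u: "u \<in> C" "\<And>w. w \<in> C \<Longrightarrow> h u \<le> h w"
    using assms(1) by (auto simp: is_arg_min_linorder)
  have "F u \<bullet> (v - u) + s * K \<ge> 0" if s: "0 < s" "s < 1" for s
  proof -
    have mem: "u + s *\<^sub>R (v - u) \<in> C"
      using segment_mem u(1) assms(2) s by auto
    have "0 \<le> s * (F u \<bullet> (v - u) + s * K)"
      using le_quadratic_upper_bound[OF u(1) mem] u(2)[OF mem] s
      by (simp add: K_def power2_eq_square distrib_left mult_ac)
    then show ?thesis using s by (simp add: zero_le_mult_iff)
  qed
  then have ev: "\<forall>\<^sub>F s in at_right 0. F u \<bullet> (v - u) + s * K \<ge> 0"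
    by (auto simp: eventually_at_right_field intro!: exI[of _ 1])
  have "((\<lambda>s. F u \<bullet> (v - u) + s * K) \<longlongrightarrow> F u \<bullet> (v - u) + 0 * K) (at_right 0)"
    by (intro tendsto_intros)
  from tendsto_lowerbound[OF this ev] show ?thesis by simp
qed

text \<open>In the expanded squared distance from \<open>u - \<gamma> *\<^sub>R F u\<close> to
  \<open>z\<close>, the cross term is nonnegative by the variational inequality, so no
  \<open>z\<close> in \<open>C\<close> is closer than \<open>u\<close>.\<close>

lemma minimizer_is_fixed_point:
  assumes "is_arg_min h (\<lambda>u. u \<in> C) u" "\<gamma> > 0"
  shows "closest_point C (u - \<gamma> *\<^sub>R F u) = u"
proof (rule closest_point_unique[symmetric, OF convex closed])
  show "u \<in> C" using assms(1) by (simp add: is_arg_min_def)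
  show "\<forall>z\<in>C. dist (u - \<gamma> *\<^sub>R F u) u \<le> dist (u - \<gamma> *\<^sub>R F u) z"
  proof
    fix z assume "z \<in> C"
    then have "0 \<le> 2 * \<gamma> * (F u \<bullet> (z - u))"
      using variational_inequality[OF assms(1)] assms(2) by simp
    moreover have "(norm (u - \<gamma> *\<^sub>R F u - z))\<^sup>2 =
        (norm (\<gamma> *\<^sub>R F u))\<^sup>2 + 2 * \<gamma> * (F u \<bullet> (z - u)) + (norm (z - u))\<^sup>2"
      unfolding power2_norm_eq_inner by (simp add: algebra_simps inner_commute)
    ultimately have "(norm (\<gamma> *\<^sub>R F u))\<^sup>2 \<le> (norm (u - \<gamma> *\<^sub>R F u - z))\<^sup>2"
      by (smt (verit) zero_le_power2)
    then show "dist (u - \<gamma> *\<^sub>R F u) u \<le> dist (u - \<gamma> *\<^sub>R F u) z"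
      by (simp add: dist_norm power2_le_iff_abs_le)
  qed
qed

end

section \<open>Monotone gradients and cocoercivity\<close>

locale monotone_lipschitz_gradient = lipschitz_gradient +
  assumes monotone: "\<And>u v. u \<in> C \<Longrightarrow> v \<in> C \<Longrightarrow> (F u - F v) \<bullet> (u - v) \<ge> 0"
begin

text \<open>At the mean value point the displacement from \<open>u\<close> is a positive multiple of
  \<open>v - u\<close>, so monotonicity compares the slope there with the slope at
  \<open>u\<close>.\<close>

lemma ge_linear_lower_bound:
  assumes "u \<in> C" "v \<in> C"
  shows "h v \<ge> h u + F u \<bullet> (v - u)"
proof -
  obtain s where s: "s \<in> {0<..<1}" and mvt:
    "h (u + 1 *\<^sub>R (v - u)) - h (u + 0 *\<^sub>R (v - u)) = (1 - 0) * (F (u + s *\<^sub>R (v - u)) \<bullet> (v - u))"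
    using mvt_simple[of 0 1 "\<lambda>s. h (u + s *\<^sub>R (v - u))", OF _ derivative_along_segment[OF assms]]
    by auto
  have "0 \<le> (F (u + s *\<^sub>R (v - u)) - F u) \<bullet> ((u + s *\<^sub>R (v - u)) - u)"
    by (intro monotone segment_mem assms) (use s in auto)
  then have "0 \<le> (F (u + s *\<^sub>R (v - u)) - F u) \<bullet> (v - u)"
    using s by (simp add: zero_le_mult_iff)
  then show ?thesis using mvt by (simp add: inner_diff_left)
qed

text \<open>\<open>P\<close> is the orthogonal projection onto \<open>V\<close>. Here
  \<open>V\<close> only has to contain all differences of points of \<open>C\<close>; that it is no
  larger than the direction space of the affine hull is assumed where the relative interior
  enters.\<close>

context
  fixes V :: "'a set" and P :: "'a \<Rightarrow> 'a"
  assumes V: "subspace V" "\<And>u v. u \<in> C \<Longrightarrow> v \<in> C \<Longrightarrow> u - v \<in> V"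
    and P: "linear P" "\<And>w. P w \<in> V" "\<And>w v. v \<in> V \<Longrightarrow> P w \<bullet> v = w \<bullet> v"
      "\<And>w. norm (P w) \<le> norm w"
begin

text \<open>The linear lower bound based at \<open>u\<close> and the quadratic upper bound based at
  \<open>v\<close> are compared at \<open>v + (1 / G) *\<^sub>R D\<close>, the point of
  \<open>v + V\<close> where their gap is smallest. The radius \<open>norm (u - v)\<close> suffices
  because \<open>P\<close> does not increase norms and \<open>F\<close> is
  \<open>G\<close>-Lipschitz.\<close>

lemma local_lower_bound:
  assumes uv: "u \<in> C" "v \<in> C"
    and ball: "\<And>p. p \<in> V \<Longrightarrow> norm p \<le> norm (u - v) \<Longrightarrow> v + p \<in> C"
  shows "h v \<ge> h u + F u \<bullet> (v - u) + 1 / (2 * G) * (norm (P (F u - F v)))\<^sup>2"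
proof -
  define D where "D = P (F u - F v)"
  have "norm D \<le> G * norm (u - v)"
    using P(4)[of "F u - F v"] norm_gradient_diff_le[OF uv] by (simp add: D_def)
  then have "norm ((1 / G) *\<^sub>R D) \<le> norm (u - v)"
    using G_pos by (simp add: field_simps)
  then have z: "v + (1 / G) *\<^sub>R D \<in> C"
    using P(2) V(1) by (intro ball) (auto simp: D_def subspace_scale)
  have inner_D: "(F u - F v) \<bullet> D = (norm D)\<^sup>2"
    using P(3)[of D "F u - F v"] P(2) by (simp add: D_def power2_norm_eq_inner)
  have "h u + F u \<bullet> (v - u) + 1 / G * (F u \<bullet> D) \<le> h (v + (1 / G) *\<^sub>R D)"
    using ge_linear_lower_bound[OF uv(1) z] by (simp add: algebra_simps)
  also have "\<dots> \<le> h v + 1 / G * (F v \<bullet> D) + G / 2 * (1 / G * norm D)\<^sup>2"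
    using le_quadratic_upper_bound[OF uv(2) z] G_pos by simp
  finally have "h u + F u \<bullet> (v - u) + 1 / G * ((F u - F v) \<bullet> D) - G / 2 * (1 / G * norm D)\<^sup>2 \<le> h v"
    by (simp add: inner_diff_left right_diff_distrib diff_divide_distrib)
  moreover have "1 / G * (norm D)\<^sup>2 - G / 2 * (1 / G * norm D)\<^sup>2 = 1 / (2 * G) * (norm D)\<^sup>2"
    using G_pos by (simp add: power2_eq_square field_simps)
  ultimately show ?thesis
    unfolding inner_D D_def[symmetric] by linarith
qed

text \<open>Adding the local lower bound to its copy with \<open>u\<close> and \<open>v\<close>
  exchanged cancels the values of \<open>h\<close>.\<close>

lemma local_cocoercive:
  assumes "u \<in> C" "v \<in> C"
    and "\<And>p. p \<in> V \<Longrightarrow> norm p \<le> norm (u - v) \<Longrightarrow> u + p \<in> C"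
    and "\<And>p. p \<in> V \<Longrightarrow> norm p \<le> norm (u - v) \<Longrightarrow> v + p \<in> C"
  shows "(norm (P (F u - F v)))\<^sup>2 \<le> G * ((F u - F v) \<bullet> (u - v))"
proof -
  have "norm (P (F v - F u)) = norm (P (F u - F v))"
    using linear_diff[OF P(1)] by (simp add: norm_minus_commute)
  then have "h u \<ge> h v + F v \<bullet> (u - v) + 1 / (2 * G) * (norm (P (F u - F v)))\<^sup>2"
    using local_lower_bound[of v u] assms by (simp add: norm_minus_commute)
  moreover have "h v \<ge> h u + F u \<bullet> (v - u) + 1 / (2 * G) * (norm (P (F u - F v)))\<^sup>2"
    using local_lower_bound[of u v] assms by simp
  ultimately have "1 / G * (norm (P (F u - F v)))\<^sup>2 \<le> (F u - F v) \<bullet> (u - v)"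
    using G_pos by (simp add: algebra_simps)
  then show ?thesis using G_pos by (simp add: field_simps)
qed

text \<open>The balls may now be much smaller than \<open>norm (u - v)\<close>: the segment is cut
  into \<open>n\<close> pieces no longer than \<open>e\<close>, and the local inequality is applied
  to each.\<close>

lemma cocoercive_between_centres:
  assumes e: "e > 0"
    and u: "u \<in> C" "\<And>p. p \<in> V \<Longrightarrow> norm p \<le> e \<Longrightarrow> u + p \<in> C"
    and v: "v \<in> C" "\<And>p. p \<in> V \<Longrightarrow> norm p \<le> e \<Longrightarrow> v + p \<in> C"
  shows "(norm (P (F u - F v)))\<^sup>2 \<le> G * ((F u - F v) \<bullet> (u - v))"
proof -
  define d where "d = u - v"
  obtain n :: nat where n: "norm d / e < real n"
    using reals_Archimedean2 by blast
  then have n0: "n > 0"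
    using e by (metis divide_nonneg_pos gr0I norm_ge_zero not_less of_nat_0)
  define w where "w i = v + (real i / real n) *\<^sub>R d" for i
  have ball: "w i + p \<in> C" if "i \<le> n" "p \<in> V" "norm p \<le> e" for i p
  proof -
    \<comment> \<open>Translating the whole segment by \<open>p\<close> keeps its endpoints in
      \<open>C\<close>, so by convexity every intermediate point inherits the ball of radius
      \<open>e\<close>.\<close>
    have "(v + p) + (real i / real n) *\<^sub>R ((u + p) - (v + p)) \<in> C"
      by (rule segment_mem) (use u v that n0 in auto)
    then show ?thesis by (simp add: w_def d_def algebra_simps)
  qed
  have mem: "w i \<in> C" if "i \<le> n" for i
    using ball[OF that, of 0] V(1) e by (simp add: subspace_0)
  have step: "w (Suc i) - w i = (1 / real n) *\<^sub>R d" for i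
    by (simp add: w_def add_divide_distrib scaleR_add_left)
  have small: "norm ((1 / real n) *\<^sub>R d) \<le> e"
    using n n0 e by (simp add: field_simps)
  define \<Delta> where "\<Delta> i = F (w (Suc i)) - F (w i)" for i
  have loc: "(norm (P (\<Delta> i)))\<^sup>2 \<le> G / real n * (\<Delta> i \<bullet> d)" if "i < n" for i
  proof -
    have "(norm (P (\<Delta> i)))\<^sup>2 \<le> G * (\<Delta> i \<bullet> (w (Suc i) - w i))"
      unfolding \<Delta>_def using that small
      by (intro local_cocoercive mem ball) (auto simp: step)
    then show ?thesis by (simp add: step)
  qed
  have sum\<Delta>: "(\<Sum>i<n. \<Delta> i) = F u - F v"
    using sum_lessThan_telescope[of "\<lambda>i. F (w i)" n] n0 by (simp add: \<Delta>_def w_def d_def)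
  have "(norm (P (F u - F v)))\<^sup>2 = (norm (\<Sum>i<n. P (\<Delta> i)))\<^sup>2"
    by (simp add: sum\<Delta>[symmetric] linear_sum[OF P(1)])
  also have "\<dots> \<le> (\<Sum>i<n. norm (P (\<Delta> i)))\<^sup>2"
    by (intro power_mono norm_sum norm_ge_zero)
  \<comment> \<open>Cauchy-Schwarz costs a factor \<open>n\<close>, which the factor
    \<open>1 / n\<close> in \<open>loc\<close> cancels; the constant \<open>G\<close> thus survives
    the chaining.\<close>
  also have "\<dots> \<le> real n * (\<Sum>i<n. (norm (P (\<Delta> i)))\<^sup>2)"
    using sum_squared_le_sum_of_squares[of "\<lambda>i. norm (P (\<Delta> i))" "{..<n}"]
    by (simp add: mult.commute)
  also have "\<dots> \<le> real n * (\<Sum>i<n. G / real n * (\<Delta> i \<bullet> d))"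
    by (intro mult_left_mono sum_mono loc) auto
  also have "\<dots> = G * ((\<Sum>i<n. \<Delta> i) \<bullet> d)"
    using n0 by (simp add: sum_distrib_left[symmetric] sum_divide_distrib[symmetric] inner_sum_left)
  finally show ?thesis by (simp add: sum\<Delta> d_def)
qed

lemma rel_interior_ball:
  assumes "u \<in> rel_interior C" "\<And>c p. c \<in> C \<Longrightarrow> p \<in> V \<Longrightarrow> c + p \<in> affine hull C"
  obtains e where "e > 0" "u \<in> C" "\<And>p. p \<in> V \<Longrightarrow> norm p \<le> e \<Longrightarrow> u + p \<in> C"
proof -
  obtain e where e: "e > 0" "u \<in> C" "cball u e \<inter> affine hull C \<subseteq> C"
    using assms(1) by (auto simp: mem_rel_interior_cball)
  then have "u + p \<in> C" if "p \<in> V" "norm p \<le> e" for p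
    using assms(2)[OF e(2) that(1)] that(2) by (auto simp: dist_norm)
  with e that show ?thesis by blast
qed

text \<open>Two points of the relative interior share the smaller of their radii. As the relative
  interior is dense in \<open>C\<close> and both sides are continuous, the inequality passes to the
  limit.\<close>

lemma cocoercive_projected:
  assumes aff: "\<And>c p. c \<in> C \<Longrightarrow> p \<in> V \<Longrightarrow> c + p \<in> affine hull C"
    and uv: "u \<in> C" "v \<in> C"
  shows "(norm (P (F u - F v)))\<^sup>2 \<le> G * ((F u - F v) \<bullet> (u - v))"
proof -
  have rel: "(norm (P (F y - F z)))\<^sup>2 \<le> G * ((F y - F z) \<bullet> (y - z))"
    if yz: "y \<in> rel_interior C" "z \<in> rel_interior C" for y z
  proof -
    obtain e1 where e1: "e1 > 0" "y \<in> C" "\<And>p. p \<in> V \<Longrightarrow> norm p \<le> e1 \<Longrightarrow> y + p \<in> C"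
      using rel_interior_ball[OF yz(1) aff] by blast
    obtain e2 where e2: "e2 > 0" "z \<in> C" "\<And>p. p \<in> V \<Longrightarrow> norm p \<le> e2 \<Longrightarrow> z + p \<in> C"
      using rel_interior_ball[OF yz(2) aff] by blast
    show ?thesis
      by (rule cocoercive_between_centres[of "min e1 e2"]) (use e1 e2 in auto)
  qed
  have cl: "closure (rel_interior C) = C"
    using convex_closure_rel_interior[OF convex] closed by simp
  obtain y where y: "\<And>n. y n \<in> rel_interior C" "y \<longlonglongrightarrow> u"
    using uv(1) cl closure_sequential[of u "rel_interior C"] by auto
  obtain z where z: "\<And>n. z n \<in> rel_interior C" "z \<longlonglongrightarrow> v"
    using uv(2) cl closure_sequential[of v "rel_interior C"] by auto
  have contF: "continuous_on C F"
    using lipschitz by (rule lipschitz_on_continuous_on)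
  have sub: "w \<in> C" if "w \<in> rel_interior C" for w
    using that rel_interior_subset by blast
  have Fy: "(\<lambda>n. F (y n)) \<longlonglongrightarrow> F u"
    by (rule continuous_on_tendsto_compose[OF contF y(2) uv(1)]) (use y(1) sub in simp)
  have Fz: "(\<lambda>n. F (z n)) \<longlonglongrightarrow> F v"
    by (rule continuous_on_tendsto_compose[OF contF z(2) uv(2)]) (use z(1) sub in simp)
  have "(\<lambda>n. P (F (y n) - F (z n))) \<longlonglongrightarrow> P (F u - F v)"
    using bounded_linear.tendsto[OF _ tendsto_diff[OF Fy Fz], of P] P(1)
    by (simp add: linear_conv_bounded_linear)
  then have lhs: "(\<lambda>n. (norm (P (F (y n) - F (z n))))\<^sup>2) \<longlonglongrightarrow> (norm (P (F u - F v)))\<^sup>2"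
    by (intro tendsto_intros)
  have rhs: "(\<lambda>n. G * ((F (y n) - F (z n)) \<bullet> (y n - z n))) \<longlonglongrightarrow> G * ((F u - F v) \<bullet> (u - v))"
    by (intro tendsto_intros Fy Fz y z)
  show ?thesis
    by (rule LIMSEQ_le[OF lhs rhs]) (use rel y z in auto)
qed

end

section \<open>Contraction of the projected gradient step\<close>

text \<open>The difference of two projections onto \<open>C\<close> lies in \<open>V\<close>, so
  only the projected gradient difference matters, and cocoercivity controls it. The
  \<open>max 0\<close> keeps the radicand nonnegative: for \<open>u = v\<close> nothing bounds
  \<open>\<eta>\<close> from above.\<close>

lemma projected_gradient_step_contraction:
  assumes uv: "u \<in> C" "v \<in> C"
    and strong: "(F u - F v) \<bullet> (u - v) \<ge> \<eta> * (norm (u - v))\<^sup>2"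
    and \<gamma>: "0 < \<gamma>" "\<gamma> < 2 / G"
  shows "norm (closest_point C (u - \<gamma> *\<^sub>R F u) - closest_point C (v - \<gamma> *\<^sub>R F v))
    \<le> sqrt (max 0 (1 - \<gamma> * (2 - \<gamma> * G) * \<eta>)) * norm (u - v)"
proof -
  define V where "V = span ((\<lambda>c. c - u) ` C)"
  have subV: "subspace V"
    by (simp add: V_def)
  have diff: "c - c' \<in> V" if "c \<in> C" "c' \<in> C" for c c'
  proof -
    have "c - u \<in> V" "c' - u \<in> V"
      using that by (auto simp: V_def intro: span_base)
    then have "(c - u) - (c' - u) \<in> V"
      using subV by (rule subspace_diff[rotated])
    then show ?thesis by simp
  qed
  have aff: "c + p \<in> affine hull C" if "c \<in> C" "p \<in> V" for c p
  proof -
    \<comment> \<open>\<open>V\<close> is spanned by differences from \<open>u\<close>, so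
      \<open>p\<close> is \<open>c' - u\<close> with \<open>c'\<close> in the affine hull; an affine
      combination then moves the starting point from \<open>u\<close> to \<open>c\<close>.\<close>
    have "p \<in> {c' - u |c'. c' \<in> affine hull C}"
    proof -
      have "affine hull C = (+) u ` span ((\<lambda>c. - u + c) ` C)"
        using affine_hull_span_gen[of u C] uv(1) by (simp add: hull_inc)
      then have "u + p \<in> affine hull C"
        using that(2) by (simp add: V_def)
      then show ?thesis by (metis (mono_tags, lifting) CollectI add_diff_cancel_left')
    qed
    then obtain c' where c': "c' \<in> affine hull C" "p = c' - u" by blast
    have "c + 1 *\<^sub>R (c' - u) \<in> affine hull C"
      by (rule mem_affine_3_minus[OF affine_affine_hull]) (use that(1) uv(1) c'(1) in \<open>auto intro: hull_inc\<close>)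
    then show ?thesis by (simp add: c'(2))
  qed
  obtain P :: "'a \<Rightarrow> 'a" where P: "linear P" "\<And>w. P w \<in> V"
    "\<And>w v. v \<in> V \<Longrightarrow> P w \<bullet> v = w \<bullet> v" "\<And>w. norm (P w) \<le> norm w"
    using projection_onto_subspace[OF subV] by metis
  define d where "d = u - v"
  define \<Delta> where "\<Delta> = F u - F v"
  have coco: "(norm (P \<Delta>))\<^sup>2 \<le> G * (\<Delta> \<bullet> d)"
    unfolding \<Delta>_def d_def by (rule cocoercive_projected[OF subV diff P aff uv])
  have d: "d \<in> V" using diff uv by (simp add: d_def)
  have "(norm (d - \<gamma> *\<^sub>R P \<Delta>))\<^sup>2 = (norm d)\<^sup>2 - 2 * \<gamma> * (P \<Delta> \<bullet> d) + \<gamma>\<^sup>2 * (norm (P \<Delta>))\<^sup>2"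
    unfolding power2_norm_eq_inner by (simp add: algebra_simps inner_commute power2_eq_square)
  also have "\<dots> = (norm d)\<^sup>2 - 2 * \<gamma> * (\<Delta> \<bullet> d) + \<gamma>\<^sup>2 * (norm (P \<Delta>))\<^sup>2"
    by (simp add: P(3)[OF d])
  also have "\<dots> \<le> (norm d)\<^sup>2 - 2 * \<gamma> * (\<Delta> \<bullet> d) + \<gamma>\<^sup>2 * (G * (\<Delta> \<bullet> d))"
    using coco by (simp add: mult_left_mono)
  also have "\<dots> = (norm d)\<^sup>2 - \<gamma> * (2 - \<gamma> * G) * (\<Delta> \<bullet> d)"
    by (simp add: algebra_simps power2_eq_square)
  \<comment> \<open>The bound on the step length makes the coefficient
    \<open>\<gamma> * (2 - \<gamma> * G)\<close> positive, so \<open>strong\<close> can be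
    inserted.\<close>
  also have "\<dots> \<le> (norm d)\<^sup>2 - \<gamma> * (2 - \<gamma> * G) * (\<eta> * (norm d)\<^sup>2)"
    using strong \<gamma> G_pos by (intro diff_left_mono mult_left_mono) (auto simp: d_def \<Delta>_def field_simps)
  also have "\<dots> = (1 - \<gamma> * (2 - \<gamma> * G) * \<eta>) * (norm d)\<^sup>2"
    by (simp add: algebra_simps)
  also have "\<dots> \<le> max 0 (1 - \<gamma> * (2 - \<gamma> * G) * \<eta>) * (norm d)\<^sup>2"
    by (intro mult_right_mono) auto
  finally have "sqrt ((norm (d - \<gamma> *\<^sub>R P \<Delta>))\<^sup>2) \<le>
      sqrt (max 0 (1 - \<gamma> * (2 - \<gamma> * G) * \<eta>) * (norm d)\<^sup>2)"
    by (rule real_sqrt_le_mono)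
  then have bound: "norm (d - \<gamma> *\<^sub>R P \<Delta>) \<le> sqrt (max 0 (1 - \<gamma> * (2 - \<gamma> * G) * \<eta>)) * norm d"
    by (simp add: real_sqrt_mult)
  define a where "a = u - \<gamma> *\<^sub>R F u"
  define b where "b = v - \<gamma> *\<^sub>R F v"
  define q where "q = closest_point C a - closest_point C b"
  have ne: "C \<noteq> {}" using uv by auto
  have cp: "closest_point C a \<in> C" "closest_point C b \<in> C"
    by (simp_all add: closest_point_in_set closed ne)
  then have q: "q \<in> V" by (simp add: q_def diff)
  \<comment> \<open>Firm nonexpansiveness: the obtuse angle inequalities of the two projections,
    each tested at the other projection, are added.\<close>
  have "(norm q)\<^sup>2 \<le> (a - b) \<bullet> q"
    using closest_point_dot[OF convex closed cp(2), of a] closest_point_dot[OF convex closed cp(1), of b]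
    unfolding q_def power2_norm_eq_inner by (simp add: algebra_simps inner_commute)
  also have "(a - b) \<bullet> q = (d - \<gamma> *\<^sub>R \<Delta>) \<bullet> q"
    by (simp add: a_def b_def d_def \<Delta>_def algebra_simps)
  also have "\<dots> = (d - \<gamma> *\<^sub>R P \<Delta>) \<bullet> q"
    by (simp add: inner_diff_left P(3)[OF q])
  also have "\<dots> \<le> norm (d - \<gamma> *\<^sub>R P \<Delta>) * norm q"
    by (rule norm_cauchy_schwarz)
  finally have "norm q \<le> norm (d - \<gamma> *\<^sub>R P \<Delta>)"
    by (cases "q = 0") (simp_all add: power2_eq_square)
  with bound show ?thesis by (simp add: q_def a_def b_def d_def)
qed

end

section \<open>Scalar estimates for the coupled recursion\<close>

lemma contraction_modulus_less_1:
  fixes \<gamma> G \<eta> :: real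
  assumes "0 < \<gamma>" "\<gamma> < 2 / G" "G > 0" "\<eta> > 0"
  shows "sqrt (max 0 (1 - \<gamma> * (2 - \<gamma> * G) * \<eta>)) < 1"
proof -
  have "0 < \<gamma> * (2 - \<gamma> * G) * \<eta>"
    using assms by (intro mult_pos_pos) (auto simp: field_simps)
  then show ?thesis by simp
qed

text \<open>With enough weight \<open>M\<close> on \<open>b\<close>, the decay of \<open>b\<close>
  absorbs the coupling \<open>c * b k\<close>, and \<open>a + M * b\<close> contracts by a single
  factor.\<close>

lemma coupled_contractions_tendsto_0:
  fixes a b :: "nat \<Rightarrow> real"
  assumes nonneg: "\<And>k. a k \<ge> 0" "\<And>k. b k \<ge> 0"
    and rec_a: "\<And>k. a (Suc k) \<le> q * a k + c * b k"
    and rec_b: "\<And>k. b (Suc k) \<le> r * b k"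
    and "q < 1" "r < 1" "c \<ge> 0"
  shows "a \<longlonglongrightarrow> 0" "b \<longlonglongrightarrow> 0"
proof -
  \<comment> \<open>The common rate exceeds both moduli strictly, leaving the slack
    \<open>p - r\<close> to pay for the coupling; being positive, it also preserves inequalities
    under multiplication.\<close>
  obtain p where p: "max 0 (max q r) < p" "p < 1"
    using dense[of "max 0 (max q r)" 1] assms by auto
  \<comment> \<open>\<open>M = c / (p - r)\<close> solves \<open>c + M * r = p * M\<close>; the summand 1 only keeps \<open>M\<close> positive.\<close>
  define M where "M = c / (p - r) + 1"
  have M: "M \<ge> 1" "c + M * r \<le> p * M"
  proof -
    define m where "m = c / (p - r)"
    have m: "m \<ge> 0" "(p - r) * m = c"
      using p assms(7) by (auto simp: m_def)
    have M: "M = m + 1" by (simp add: M_def m_def)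
    show "M \<ge> 1" using m(1) M by simp
    show "c + M * r \<le> p * M"
      unfolding M m(2)[symmetric] using p by (simp add: algebra_simps)
  qed
  define W where "W k = a k + M * b k" for k
  have step: "W (Suc k) \<le> p * W k" for k
  proof -
    have "W (Suc k) \<le> (q * a k + c * b k) + M * (r * b k)"
      unfolding W_def using rec_a rec_b M(1) by (intro add_mono mult_left_mono) auto
    also have "\<dots> = q * a k + (c + M * r) * b k"
      by (simp add: algebra_simps)
    also have "\<dots> \<le> p * a k + (p * M) * b k"
      using p M nonneg by (intro add_mono mult_right_mono) auto
    finally show ?thesis by (simp add: W_def algebra_simps)
  qed
  have W: "W k \<le> p ^ k * W 0" for k
  proof (induction k)
    case (Suc k)
    have "W (Suc k) \<le> p * (p ^ k * W 0)"
      using step[of k] mult_left_mono[OF Suc, of p] p by linarith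
    then show ?case by simp
  qed simp
  have "(\<lambda>k. p ^ k * W 0) \<longlonglongrightarrow> 0 * W 0"
    using p by (intro tendsto_intros LIMSEQ_realpow_zero) auto
  then have lim: "(\<lambda>k. p ^ k * W 0) \<longlonglongrightarrow> 0" by simp
  have Mb: "b k \<le> M * b k" for k
    using M(1) nonneg(2)[of k] mult_right_mono[of 1 M "b k"] by simp
  have "a k \<le> p ^ k * W 0" "b k \<le> p ^ k * W 0" for k
    using W[of k] Mb[of k] nonneg[of k] by (auto simp: W_def)
  with nonneg show "a \<longlonglongrightarrow> 0" "b \<longlonglongrightarrow> 0"
    by (auto intro!: tendsto_sandwich[OF _ _ tendsto_const lim])
qed

section \<open>Convergence of the joint scheme\<close>

text \<open>The Lipschitz and strong convexity conditions on \<open>g\<close> are imposed on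
  \<open>\<Theta>\<close> only, which includes the case where they hold on the whole space.\<close>

theorem proposition2:
  fixes X :: "(real ^ 'n) set" and \<Theta> :: "(real ^ 'm) set"
    and f :: "real ^ 'n \<Rightarrow> real ^ 'm \<Rightarrow> real" and dfx :: "real ^ 'n \<Rightarrow> real ^ 'm \<Rightarrow> real ^ 'n"
    and g :: "real ^ 'm \<Rightarrow> real" and dg :: "real ^ 'm \<Rightarrow> real ^ 'm"
    and Gfx Gg \<eta>f \<eta>g L\<theta> \<gamma>f \<gamma>g :: real
    and \<gamma>fs \<gamma>gs :: "nat \<Rightarrow> real"
    and xstar :: "real ^ 'n" and \<theta>star :: "real ^ 'm"
    and x :: "nat \<Rightarrow> real ^ 'n" and \<theta> :: "nat \<Rightarrow> real ^ 'm"
  assumes "X \<noteq> {}" and "closed X" and "convex X"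
    and "\<Theta> \<noteq> {}" and "closed \<Theta>" and "convex \<Theta>"
    and "\<And>t. t \<in> \<Theta> \<Longrightarrow> convex_on X (\<lambda>y. f y t)"
    and "convex_on UNIV g"
    and "\<And>t. t \<in> \<Theta> \<Longrightarrow> continuously_differentiable_on (\<lambda>y. f y t) (\<lambda>y. dfx y t) X"
    and "continuously_differentiable_on g dg UNIV"
    and "Gfx > 0" and "Gg > 0"
    and "\<And>t. t \<in> \<Theta> \<Longrightarrow> Gfx-lipschitz_on X (\<lambda>y. dfx y t)"
    and "Gg-lipschitz_on \<Theta> dg"
    and "\<eta>f > 0" and "\<eta>g > 0"
    and "\<And>t. t \<in> \<Theta> \<Longrightarrow> strongly_convex_on \<eta>f (\<lambda>y. f y t) (\<lambda>y. dfx y t) X"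
    and "strongly_convex_on \<eta>g g dg \<Theta>"
    and "is_arg_min g (\<lambda>t. t \<in> \<Theta>) \<theta>star"
    and "is_arg_min (\<lambda>y. f y \<theta>star) (\<lambda>y. y \<in> X) xstar"
    and "L\<theta>-lipschitz_on \<Theta> (\<lambda>t. dfx xstar t)"
    and "\<And>k. \<gamma>fs k = \<gamma>f" and "\<And>k. \<gamma>gs k = \<gamma>g"
    and "0 < \<gamma>f" and "\<gamma>f < 2 / Gfx"
    and "0 < \<gamma>g" and "\<gamma>g < 2 / Gg"
    and "joint_gradient_scheme X \<Theta> dfx dg \<gamma>fs \<gamma>gs x \<theta>"
  shows "x \<longlonglongrightarrow> xstar \<and> \<theta> \<longlonglongrightarrow> \<theta>star"
proof -
  let ?qf = "sqrt (max 0 (1 - \<gamma>f * (2 - \<gamma>f * Gfx) * \<eta>f))"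
  let ?qg = "sqrt (max 0 (1 - \<gamma>g * (2 - \<gamma>g * Gg) * \<eta>g))"
  note X = assms(1-3) and \<Theta> = assms(4-6)
  have fstrong: "(dfx u t - dfx v t) \<bullet> (u - v) \<ge> \<eta>f * (norm (u - v))\<^sup>2"
    if "t \<in> \<Theta>" "u \<in> X" "v \<in> X" for t u v
    using assms(17)[OF that(1)] that by (simp add: strongly_convex_on_def)
  have gstrong: "(dg u - dg v) \<bullet> (u - v) \<ge> \<eta>g * (norm (u - v))\<^sup>2" if "u \<in> \<Theta>" "v \<in> \<Theta>" for u v
    using assms(18) that by (simp add: strongly_convex_on_def)
  have f_loc: "monotone_lipschitz_gradient X (\<lambda>y. f y t) (\<lambda>y. dfx y t) Gfx" if t: "t \<in> \<Theta>" for t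
  proof
    show "((\<lambda>y. f y t) has_derivative (\<bullet>) (dfx u t)) (at u within X)" if "u \<in> X" for u
      using assms(17)[OF t] that by (simp add: strongly_convex_on_def has_gradient_on_def)
    show "0 \<le> (dfx u t - dfx v t) \<bullet> (u - v)" if "u \<in> X" "v \<in> X" for u v
      using fstrong[OF t that] \<open>\<eta>f > 0\<close> by (smt (verit) mult_nonneg_nonneg zero_le_power2)
  qed (use X \<open>Gfx > 0\<close> assms(13)[OF t] in auto)
  have g_loc: "monotone_lipschitz_gradient \<Theta> g dg Gg"
  proof
    show "(g has_derivative (\<bullet>) (dg u)) (at u within \<Theta>)" if "u \<in> \<Theta>" for u
      using assms(18) that by (simp add: strongly_convex_on_def has_gradient_on_def)
    show "0 \<le> (dg u - dg v) \<bullet> (u - v)" if "u \<in> \<Theta>" "v \<in> \<Theta>" for u v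
      using gstrong[OF that] \<open>\<eta>g > 0\<close> by (smt (verit) mult_nonneg_nonneg zero_le_power2)
  qed (use \<Theta> \<open>Gg > 0\<close> assms(14) in auto)
  have star: "\<theta>star \<in> \<Theta>" "xstar \<in> X"
    using assms(19,20) by (simp_all add: is_arg_min_def)
  have x_Suc: "x (Suc k) = closest_point X (x k - \<gamma>f *\<^sub>R dfx (x k) (\<theta> k))"
    and \<theta>_Suc: "\<theta> (Suc k) = closest_point \<Theta> (\<theta> k - \<gamma>g *\<^sub>R dg (\<theta> k))" for k
    using assms(28) by (simp_all add: joint_gradient_scheme_def assms(22,23))
  have x_mem: "x k \<in> X" and \<theta>_mem: "\<theta> k \<in> \<Theta>" for k
    by (cases k; use assms(28) X \<Theta> in
      \<open>simp add: joint_gradient_scheme_def closest_point_in_set\<close>)+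
  have x_fix: "closest_point X (xstar - \<gamma>f *\<^sub>R dfx xstar \<theta>star) = xstar"
    using lipschitz_gradient.minimizer_is_fixed_point
      [OF monotone_lipschitz_gradient.axioms(1)[OF f_loc[OF star(1)]] assms(20) \<open>0 < \<gamma>f\<close>] .
  have \<theta>_fix: "closest_point \<Theta> (\<theta>star - \<gamma>g *\<^sub>R dg \<theta>star) = \<theta>star"
    using lipschitz_gradient.minimizer_is_fixed_point
      [OF monotone_lipschitz_gradient.axioms(1)[OF g_loc] assms(19) \<open>0 < \<gamma>g\<close>] .
  have rec_\<theta>: "norm (\<theta> (Suc k) - \<theta>star) \<le> ?qg * norm (\<theta> k - \<theta>star)" for k
    using monotone_lipschitz_gradient.projected_gradient_step_contraction
      [OF g_loc \<theta>_mem[of k] star(1) gstrong[OF \<theta>_mem[of k] star(1)] \<open>0 < \<gamma>g\<close> \<open>\<gamma>g < 2 / Gg\<close>]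
    by (simp add: \<theta>_Suc \<theta>_fix)
  have rec_x: "norm (x (Suc k) - xstar) \<le> ?qf * norm (x k - xstar) + \<gamma>f * L\<theta> * norm (\<theta> k - \<theta>star)" for k
  proof -
    \<comment> \<open>The only point at which the dependence of the gradient on the parameter is controlled is \<open>xstar\<close>.\<close>
    let ?y = "closest_point X (xstar - \<gamma>f *\<^sub>R dfx xstar (\<theta> k))"
    have "norm (x (Suc k) - ?y) \<le> ?qf * norm (x k - xstar)"
      using monotone_lipschitz_gradient.projected_gradient_step_contraction
        [OF f_loc[OF \<theta>_mem[of k]] x_mem[of k] star(2) fstrong[OF \<theta>_mem[of k] x_mem[of k] star(2)]
          \<open>0 < \<gamma>f\<close> \<open>\<gamma>f < 2 / Gfx\<close>]
      by (simp add: x_Suc)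
    moreover have "norm (?y - xstar) \<le> \<gamma>f * L\<theta> * norm (\<theta> k - \<theta>star)"
    proof -
      \<comment> \<open>By \<open>x_fix\<close>, \<open>xstar\<close> is itself a projected step,
        taken with parameter \<open>\<theta>star\<close>; nonexpansiveness of the projection leaves
        only the difference of the two gradients at \<open>xstar\<close>.\<close>
      have "norm (?y - xstar) \<le>
          dist (xstar - \<gamma>f *\<^sub>R dfx xstar (\<theta> k)) (xstar - \<gamma>f *\<^sub>R dfx xstar \<theta>star)"
        using closest_point_lipschitz[OF X(3,2,1)] x_fix by (metis dist_norm)
      also have "\<dots> = \<gamma>f * dist (dfx xstar (\<theta> k)) (dfx xstar \<theta>star)"
        using \<open>0 < \<gamma>f\<close> by (simp add: dist_norm norm_minus_commute flip: scaleR_diff_right)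
      also have "\<dots> \<le> \<gamma>f * (L\<theta> * dist (\<theta> k) \<theta>star)"
        using lipschitz_onD[OF assms(21) \<theta>_mem[of k] star(1)] \<open>0 < \<gamma>f\<close> by (simp add: mult_left_mono)
      finally show ?thesis by (simp add: dist_norm)
    qed
    moreover have "norm (x (Suc k) - xstar) \<le> norm (x (Suc k) - ?y) + norm (?y - xstar)"
      using norm_triangle_ineq[of "x (Suc k) - ?y" "?y - xstar"] by simp
    ultimately show ?thesis by linarith
  qed
  have "\<gamma>f * L\<theta> \<ge> 0"
    using lipschitz_on_nonneg[OF assms(21)] \<open>0 < \<gamma>f\<close> by simp
  moreover have "?qf < 1" "?qg < 1"
    by (intro contraction_modulus_less_1 assms)+
  ultimately have "(\<lambda>k. norm (x k - xstar)) \<longlonglongrightarrow> 0" "(\<lambda>k. norm (\<theta> k - \<theta>star)) \<longlonglongrightarrow> 0"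
    using coupled_contractions_tendsto_0[of "\<lambda>k. norm (x k - xstar)" "\<lambda>k. norm (\<theta> k - \<theta>star)",
      OF _ _ rec_x rec_\<theta>] by simp_all
  then show ?thesis
    by (simp add: LIM_zero_iff tendsto_norm_zero_iff)
qed

end
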